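(* Let $\mathcal{H}$ be a separable Hilbert space and let $\{W_i \}_{i\in I}$ be a frame of subspaces with respect to $\{v_i\}_{i \in I}$ for $\mathcal{H}$ with frame bounds $C$ and $D$. Then the frame operator $S_{W,v}$ for $\{W_i \}_{i\in I}$ and $\{v_i\}_{i \in I}$ is a positive, self-adjoint, invertible operator on $\mathcal{H}$ with $C\,\mathrm{Id}\le S_{W,v} \le D\,\mathrm{Id}$, where $\mathrm{Id}$ is the identity operator on $\mathcal{H}$. Further, we have the reconstruction formula \[ f = T_{S_{W,v}^{-1}W,v}\, T_{W,v}^* (f) = \sum_{i \in I} v_i^2 S_{W,v}^{-1} \pi_{W_i}(f) \quad \text{for all } f \in \mathcal{H}.\]
   Context: For a closed subspace $W$ of $\mathcal{H}$, $\pi_W$ denotes the orthogonal projection of $\mathcal{H}$ onto $W$. Given weights $v_i>0$ ($i\in I$), a family $\{W_i\}_{i\in I}$ of closed subspaces of $\mathcal{H}$ is a frame of subspaces with respect to $\{v_i\}_{i\in I}$ for $\mathcal{H}$ with frame bounds $C,D$ if $0<C\le D<\infty$ and $C\|f\|^2 \le \sum_{i\in I} v_i^2\|\pi_{W_i}(f)\|^2 \le D\|f\|^2$ for all $f\in\mathcal{H}$. Let $\left(\sum_{i\in I}\oplus W_i\right)_{\ell_2}$ be the space of all families $\{f_i\}_{i\in I}$ with $f_i\in W_i$ and $\sum_{i\in I}\|f_i\|^2<\infty$, with inner product $\sum_{i\in I}\langle f_i,g_i\rangle$. The synthesis operator for $\{W_i\}_{i\in I}$ and $\{v_i\}_{i\in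 I}$ is $T_{W,v}:\left(\sum_{i\in I}\oplus W_i\right)_{\ell_2}\to\mathcal{H}$, $T_{W,v}(\{f_i\}_{i\in I})=\sum_{i\in I}v_if_i$; its adjoint, the analysis operator, is $T_{W,v}^*(f)=\{v_i\pi_{W_i}(f)\}_{i\in I}$. The frame operator is $S_{W,v}=T_{W,v}T_{W,v}^*$, that is, $S_{W,v}(f) = \sum_{i\in I} v_i^2\pi_{W_i}(f)$. The symbol $T_{S_{W,v}^{-1}W,v}$ denotes the synthesis operator for the family $\{S_{W,v}^{-1}W_i\}_{i\in I}$ (called the dual frame of subspaces) and the same weights $\{v_i\}_{i\in I}$.
   Formalization: In the reconstruction formula, S_{W,v}^{-1} is applied to each component of T_{W,v}^*(f) before T_{S_{W,v}^{-1}W,v}; the literal composition is ill-defined or gives S_{W,v}(f) (e.g. one subspace W=H with weight 2 gives 4f). *)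

theory Defs
  imports "HOL-Analysis.Analysis" "Jordan_Normal_Form.Conjugate"
begin

text \<open>
  The scalar field is the real or the complex numbers. Up to isomorphism a complete
  \<^class>\<open>real_normed_field\<close> is one of these two (Gelfand-Mazur); the axioms fix the conjugation and
  the partial order, in which a scalar is nonnegative iff it is a nonnegative real number.
\<close>

class real_or_complex = real_normed_field + banach + conjugatable_ordered_field +
  assumes mult_conjugate: "x * conjugate x = (norm x)\<^sup>2 *\<^sub>R 1"
    and nonneg_iff_norm: "0 \<le> x \<longleftrightarrow> x = norm x *\<^sub>R 1"

instance real :: real_or_complex
  by standard (auto simp: power2_eq_square)

instance complex :: real_or_complex
proof
  fix z :: complex
  show "z * conjugate z = (norm z)\<^sup>2 *\<^sub>R 1"
    using complex_norm_square[of z] by (simp add: scaleR_conv_of_real)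
  show "0 \<le> z \<longleftrightarrow> z = norm z *\<^sub>R 1"
    by (auto simp: less_eq_complex_def complex_eq_iff cmod_eq_Re)
qed

text \<open>
  The whole type \<^typ>\<open>'a\<close> carries the Hilbert space; its completeness is the class \<^class>\<open>banach\<close>.
  The inner product is linear in the first argument.
\<close>

locale hilbert_space = vector_space smul
  for smul :: "'k::real_or_complex \<Rightarrow> 'a::banach \<Rightarrow> 'a" +
  fixes ip :: "'a \<Rightarrow> 'a \<Rightarrow> 'k"
  assumes smul_of_real: "smul (of_real r) x = r *\<^sub>R x"
    and ip_add_left: "ip (x + y) z = ip x z + ip y z"
    and ip_smul_left: "ip (smul c x) y = c * ip x y"
    and ip_commute: "ip y x = conjugate (ip x y)"
    and ip_self: "ip x x = of_real ((norm x)\<^sup>2)"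

lemma hilbert_space_real_inner:
  "hilbert_space (scaleR :: real \<Rightarrow> 'a::{real_inner,banach} \<Rightarrow> 'a) inner"
  by unfold_locales
    (auto simp: inner_add_left inner_add_right inner_commute power2_norm_eq_inner scaleR_add_right scaleR_add_left)

lemma hilbert_space_complex: "hilbert_space ((*) :: complex \<Rightarrow> _) (\<lambda>x y. x * cnj y)"
  by unfold_locales (use complex_norm_square in \<open>auto simp: algebra_simps scaleR_conv_of_real\<close>)

definition closed_subspace :: "('k::field \<Rightarrow> 'a::banach \<Rightarrow> 'a) \<Rightarrow> 'a set \<Rightarrow> bool" where
  "closed_subspace smul W \<longleftrightarrow> module.subspace smul W \<and> closed W"

definition oproj :: "('a::banach \<Rightarrow> 'a \<Rightarrow> 'k::real_or_complex) \<Rightarrow> 'a set \<Rightarrow> 'a \<Rightarrow> 'a" where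
  "oproj ip W f = (THE p. p \<in> W \<and> (\<forall>w\<in>W. ip (f - p) w = 0))"

text \<open>Bounded operators that are linear over the scalar field, and the order on operators.\<close>

definition bounded_operator :: "('k::field \<Rightarrow> 'a::banach \<Rightarrow> 'a) \<Rightarrow> ('a \<Rightarrow> 'a) \<Rightarrow> bool" where
  "bounded_operator smul A \<longleftrightarrow> Vector_Spaces.linear smul smul A \<and> bounded_linear A"

definition invertible_operator :: "('k::field \<Rightarrow> 'a::banach \<Rightarrow> 'a) \<Rightarrow> ('a \<Rightarrow> 'a) \<Rightarrow> bool" where
  "invertible_operator smul A \<longleftrightarrow> (\<exists>B. bounded_operator smul B \<and> A \<circ> B = id \<and> B \<circ> A = id)"

definition self_adjoint :: "('a \<Rightarrow> 'a \<Rightarrow> 'k) \<Rightarrow> ('a \<Rightarrow> 'a) \<Rightarrow> bool" where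
  "self_adjoint ip A \<longleftrightarrow> (\<forall>f g. ip (A f) g = ip f (A g))"

definition positive_operator :: "('a::banach \<Rightarrow> 'a \<Rightarrow> 'k::real_or_complex) \<Rightarrow> ('a \<Rightarrow> 'a) \<Rightarrow> bool" where
  "positive_operator ip A \<longleftrightarrow> (\<forall>f. 0 \<le> ip (A f) f)"

definition operator_le ::
    "('a::banach \<Rightarrow> 'a \<Rightarrow> 'k::real_or_complex) \<Rightarrow> ('a \<Rightarrow> 'a) \<Rightarrow> ('a \<Rightarrow> 'a) \<Rightarrow> bool" where
  "operator_le ip A B \<longleftrightarrow> positive_operator ip (\<lambda>f. B f - A f)"

text \<open>All sums over the index set are unordered sums.\<close>

definition frame_of_subspaces ::
    "('k::real_or_complex \<Rightarrow> 'a::banach \<Rightarrow> 'a) \<Rightarrow> ('a \<Rightarrow> 'a \<Rightarrow> 'k) \<Rightarrow>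
     'i set \<Rightarrow> ('i \<Rightarrow> 'a set) \<Rightarrow> ('i \<Rightarrow> real) \<Rightarrow> real \<Rightarrow> real \<Rightarrow> bool" where
  "frame_of_subspaces smul ip I W v C D \<longleftrightarrow>
     (\<forall>i\<in>I. closed_subspace smul (W i)) \<and> (\<forall>i\<in>I. 0 < v i) \<and> 0 < C \<and> C \<le> D \<and>
     (\<forall>f. (\<lambda>i. (v i)\<^sup>2 * (norm (oproj ip (W i) f))\<^sup>2) summable_on I \<and>
          C * (norm f)\<^sup>2 \<le> (\<Sum>\<^sub>\<infinity>i\<in>I. (v i)\<^sup>2 * (norm (oproj ip (W i) f))\<^sup>2) \<and>
          (\<Sum>\<^sub>\<infinity>i\<in>I. (v i)\<^sup>2 * (norm (oproj ip (W i) f))\<^sup>2) \<le> D * (norm f)\<^sup>2)"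

text \<open>The direct sum of the \<open>W i\<close>, consisting of families indexed by \<open>I\<close> (\<open>undefined\<close> outside \<open>I\<close>).\<close>

definition l2_sum :: "'i set \<Rightarrow> ('i \<Rightarrow> 'a::banach set) \<Rightarrow> ('i \<Rightarrow> 'a) set" where
  "l2_sum I W = {h \<in> Pi\<^sub>E I W. (\<lambda>i. (norm (h i))\<^sup>2) summable_on I}"

definition l2_ip :: "('a::banach \<Rightarrow> 'a \<Rightarrow> 'k::real_or_complex) \<Rightarrow> 'i set \<Rightarrow>
    ('i \<Rightarrow> 'a) \<Rightarrow> ('i \<Rightarrow> 'a) \<Rightarrow> 'k" where
  "l2_ip ip I h g = (\<Sum>\<^sub>\<infinity>i\<in>I. ip (h i) (g i))"

text \<open>The subspaces \<open>W\<close> enter only through the domain: outside \<open>l2_sum I W\<close> the value is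
  \<^const>\<open>undefined\<close>.\<close>

definition synthesis :: "'i set \<Rightarrow> ('i \<Rightarrow> 'a::banach set) \<Rightarrow> ('i \<Rightarrow> real) \<Rightarrow> ('i \<Rightarrow> 'a) \<Rightarrow> 'a" where
  "synthesis I W v = (\<lambda>h\<in>l2_sum I W. \<Sum>\<^sub>\<infinity>i\<in>I. v i *\<^sub>R h i)"

text \<open>The Hilbert space adjoint of \<open>synthesis I W v\<close>.\<close>

definition analysis :: "('a::banach \<Rightarrow> 'a \<Rightarrow> 'k::real_or_complex) \<Rightarrow>
    'i set \<Rightarrow> ('i \<Rightarrow> 'a set) \<Rightarrow> ('i \<Rightarrow> real) \<Rightarrow> 'a \<Rightarrow> ('i \<Rightarrow> 'a)" where
  "analysis ip I W v f =
     (THE g. g \<in> l2_sum I W \<and> (\<forall>h\<in>l2_sum I W. ip (synthesis I W v h) f = l2_ip ip I h g))"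

definition frame_operator :: "('a::banach \<Rightarrow> 'a \<Rightarrow> 'k::real_or_complex) \<Rightarrow>
    'i set \<Rightarrow> ('i \<Rightarrow> 'a set) \<Rightarrow> ('i \<Rightarrow> real) \<Rightarrow> 'a \<Rightarrow> 'a" where
  "frame_operator ip I W v f = synthesis I W v (analysis ip I W v f)"

text \<open>
  The family \<open>analysis ip I W v f\<close> lies in the direct sum of the \<open>W i\<close>, whereas the synthesis operator
  of the dual frame of subspaces acts on the direct sum of the \<open>inv S ` W i\<close>. In the reconstruction
  formula the former is carried to the latter by applying \<open>inv S\<close> componentwise, in accordance with
  the terms of its series.
\<close>

end

theory Submission
  imports Defs
begin

text \<open>
  Everything rests on the identity \<open>ip (S f) f = (\<Sum>\<^sub>\<infinity>i\<in>I. (v i)\<^sup>2 * (norm (P i f))\<^sup>2)\<close>, where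
  \<open>P i\<close> is the orthogonal projection onto \<open>W i\<close>: the frame inequality is literally the statement
  \<open>C Id \<le> S \<le> D Id\<close>. What needs proof is that \<open>S\<close> is a well-defined bounded operator and that it is
  invertible.

  For the first point, the upper frame bound says that the analysis operator
  \<open>f \<mapsto> (v i P i f)\<close> has norm at most \<open>sqrt D\<close>. Its dual form, obtained by testing a finite
  sum against itself, bounds the norm of the synthesis operator on finitely supported families
  (\<open>norm_finite_synthesis\<close>). In the direct sum, this makes the finite partial sums of the synthesis
  series a Cauchy net. Such series need not converge absolutely, so convergence is
  derived from the squared estimate (\<open>summable_on_if_norm_sum_square_le\<close>). The adjoint of synthesis
  is then computed termwise, since \<open>ip w f = ip w (P i f)\<close> for \<open>w\<close> in \<open>W i\<close>, and
  \<open>S f = (\<Sum>\<^sub>\<infinity>i\<in>I. (v i)\<^sup>2 P i f)\<close> follows.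

  For invertibility, the lower frame bound and the Cauchy-Schwarz inequality give
  \<open>C * norm f \<le> norm (S f)\<close>. Hence \<open>S\<close> is injective with closed range, and the inverse is bounded on
  the range. A vector orthogonal to the range lies in the kernel of the self-adjoint operator \<open>S\<close>, so it
  vanishes; by the projection theorem the range is the whole space
  (\<open>self_adjoint_bounded_below_surj\<close>). Applying the bounded operator \<open>inv S\<close> to the series of
  \<open>S f\<close> term by term yields the reconstruction formula.
\<close>

section \<open>Unordered sums and operators that are bounded below\<close>

text \<open>
  The tails of the series of \<open>a\<close> bound the squared norms of the tails of the series of \<open>f\<close>, so the
  finite partial sums of \<open>f\<close> form a Cauchy net. In contrast to the comparison test, no absolute
  convergence is involved: orthogonal families satisfy the hypothesis with \<open>a x = (norm (f x))\<^sup>2\<close>.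
\<close>

lemma summable_on_if_norm_sum_square_le:
  fixes f :: "'i \<Rightarrow> 'a::banach" and a :: "'i \<Rightarrow> real"
  assumes a: "a summable_on A"
    and le: "\<And>F. finite F \<Longrightarrow> F \<subseteq> A \<Longrightarrow> (norm (sum f F))\<^sup>2 \<le> sum a F"
  shows "f summable_on A"
proof -
  have a_nonneg: "0 \<le> a x" if "x \<in> A" for x
    using le[of "{x}"] that by (simp add: order_trans[OF zero_le_power2])
  have "\<exists>P. eventually P (finite_subsets_at_top A) \<and>
              (\<forall>F F'. P F \<and> P F' \<longrightarrow> dist (sum f F) (sum f F') < e)" if "e > 0" for e
  proof -
    obtain F0 where F0: "finite F0" "F0 \<subseteq> A" and approx: "dist (sum a F0) (infsum a A) \<le> (e/3)\<^sup>2"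
      using infsum_finite_approximation[OF a, of "(e/3)\<^sup>2"] \<open>e > 0\<close> by auto
    define P where "P F \<longleftrightarrow> finite F \<and> F0 \<subseteq> F \<and> F \<subseteq> A" for F
    \<comment> \<open>Beyond \<open>F0\<close>, every partial sum of \<open>f\<close> is within \<open>e/3\<close> of the one over \<open>F0\<close>.\<close>
    have "eventually P (finite_subsets_at_top A)"
      unfolding eventually_finite_subsets_at_top P_def using F0 by auto
    moreover have near: "dist (sum f F) (sum f F0) \<le> e/3" if "P F" for F
    proof -
      have F: "finite F" "F0 \<subseteq> F" "F \<subseteq> A" using that by (auto simp: P_def)
      have "(norm (sum f (F - F0)))\<^sup>2 \<le> sum a (F - F0)" using F by (intro le) auto
      also have "\<dots> = sum a F - sum a F0" using F by (simp add: sum_diff)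
      also have "\<dots> \<le> infsum a A - sum a F0"
        using finite_sum_le_infsum[OF a F(1,3)] a_nonneg by auto
      also have "\<dots> \<le> (e/3)\<^sup>2" using approx by (simp add: dist_real_def)
      finally have "norm (sum f (F - F0)) \<le> e/3"
        by (rule power2_le_imp_le) (use \<open>e > 0\<close> in simp)
      then show ?thesis using F by (simp add: sum_diff dist_norm)
    qed
    moreover have "dist (sum f F) (sum f F') < e" if "P F" "P F'" for F F'
      using near[OF that(1)] near[OF that(2)] \<open>e > 0\<close>
        dist_triangle2[of "sum f F" "sum f F'" "sum f F0"] by linarith
    ultimately show ?thesis by blast
  qed
  then have "cauchy_filter (filtermap (sum f) (finite_subsets_at_top A))"
    by (simp add: cauchy_filter_metric_filtermap)
  moreover have "complete (UNIV :: 'a set)"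
    by (meson Cauchy_convergent UNIV_I complete_def convergent_def)
  ultimately obtain L where "(sum f \<longlongrightarrow> L) (finite_subsets_at_top A)"
    using complete_uniform[where S=UNIV] by (force simp: filterlim_def)
  then show ?thesis
    using summable_on_def has_sum_def by blast
qed

lemma closed_range_if_bounded_below:
  fixes f :: "'a::banach \<Rightarrow> 'b::banach"
  assumes "bounded_linear f" "0 < c" "\<And>x. c * norm x \<le> norm (f x)"
  shows "closed (range f)"
proof -
  have "complete (UNIV :: 'a set)"
    by (meson Cauchy_convergent UNIV_I complete_def convergent_def)
  then have "complete (range f)"
    using assms by (intro complete_isometric_image[of c]) auto
  then show ?thesis by (rule complete_imp_closed)
qed

section \<open>Conjugation and nonnegativity of scalars\<close>

lemma conjugate_of_real: "conjugate (of_real r :: 'k::real_or_complex) = of_real r"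
proof (cases "r = 0")
  case False
  have "of_real r * conjugate (of_real r :: 'k) = of_real r * of_real r"
    using mult_conjugate[of "of_real r :: 'k"] by (simp add: scaleR_conv_of_real power2_eq_square flip: of_real_mult)
  then show ?thesis using False by simp
qed simp

lemma of_real_nonneg: "0 \<le> r \<Longrightarrow> 0 \<le> (of_real r :: 'k::real_or_complex)"
  by (simp add: nonneg_iff_norm scaleR_conv_of_real)

section \<open>Geometry of the inner product\<close>

context hilbert_space
begin

lemma ip_conjugate: "conjugate (ip x y) = ip y x"
  using ip_commute[of y x] by simp

lemma ip_scaleR_left: "ip (r *\<^sub>R x) y = of_real r * ip x y"
  using ip_smul_left[of "of_real r" x y] by (simp add: smul_of_real)

lemma ip_zero_left [simp]: "ip 0 y = 0"
  using ip_scaleR_left[of 0 0 y] by simp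

lemma ip_zero_right [simp]: "ip y 0 = 0"
  using ip_commute[of y 0] by simp

lemma ip_minus_left: "ip (- x) y = - ip x y"
  using ip_scaleR_left[of "-1" x y] by simp

lemma ip_diff_left: "ip (x - y) z = ip x z - ip y z"
  using ip_add_left[of x "- y" z] by (simp add: ip_minus_left)

lemma ip_add_right: "ip z (x + y) = ip z x + ip z y"
  by (metis ip_conjugate ip_add_left conjugate_dist_add)

lemma ip_diff_right: "ip z (x - y) = ip z x - ip z y"
  by (metis ip_add_right add_diff_cancel_right' diff_add_cancel)

lemma ip_scaleR_right: "ip z (r *\<^sub>R x) = of_real r * ip z x"
  by (metis ip_conjugate ip_scaleR_left conjugate_dist_mul conjugate_of_real)

lemma ip_smul_right: "ip z (smul c x) = conjugate c * ip z x"
  by (metis ip_conjugate ip_smul_left conjugate_dist_mul)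

lemma ip_self_eq_0_iff: "ip x x = 0 \<longleftrightarrow> x = 0"
  by (simp add: ip_self)

lemma smul_scaleR_commute: "smul c (r *\<^sub>R x) = r *\<^sub>R smul c x"
  by (metis smul_of_real scale_left_commute)

lemma norm_smul: "norm (smul c x) = norm c * norm x"
proof -
  have "(of_real ((norm (smul c x))\<^sup>2) :: 'k) = (c * conjugate c) * ip x x"
    by (simp only: ip_smul_left ip_smul_right mult_ac flip: ip_self)
  also have "\<dots> = of_real ((norm c * norm x)\<^sup>2)"
    by (simp add: mult_conjugate ip_self scaleR_conv_of_real power_mult_distrib)
  finally show ?thesis by (simp only: of_real_eq_iff) (simp add: power2_eq_iff_nonneg)
qed

lemma bounded_linear_smul: "bounded_linear (smul c)"
  by (rule bounded_linear_intro[where K="norm c"])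
    (auto simp: scale_right_distrib smul_scaleR_commute norm_smul)

lemma parallelogram_law:
  fixes x y :: 'a
  shows "(norm (x + y))\<^sup>2 + (norm (x - y))\<^sup>2 = 2 * (norm x)\<^sup>2 + 2 * (norm y)\<^sup>2"
proof -
  have "ip (x + y) (x + y) + ip (x - y) (x - y) = 2 * ip x x + 2 * ip y y"
    by (simp add: ip_add_left ip_add_right ip_diff_left ip_diff_right)
  then have "(of_real ((norm (x + y))\<^sup>2 + (norm (x - y))\<^sup>2) :: 'k) =
      of_real (2 * (norm x)\<^sup>2 + 2 * (norm y)\<^sup>2)"
    by (simp add: ip_self)
  then show ?thesis by (simp only: of_real_eq_iff)
qed

text \<open>
  Pythagoras: the subtracted vector is the component of \<open>x\<close> along \<open>y\<close>. Nonnegativity of the left-hand side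
  is the Cauchy-Schwarz inequality; the strict decrease when \<open>ip x y \<noteq> 0\<close> forces a nearest point of a
  subspace to be an orthogonal projection.
\<close>

lemma norm_minus_component:
  assumes "y \<noteq> 0"
  shows "(norm (x - smul (ip x y / of_real ((norm y)\<^sup>2)) y))\<^sup>2 =
    (norm x)\<^sup>2 - (norm (ip x y))\<^sup>2 / (norm y)\<^sup>2"
proof -
  define c :: 'k where "c = ip x y / of_real ((norm y)\<^sup>2)"
  define z where "z = x - smul c y"
  have ny: "of_real ((norm y)\<^sup>2) \<noteq> (0::'k)" using assms by simp
  have orth: "ip z y = 0"
    using ny by (simp add: z_def c_def ip_diff_left ip_smul_left ip_self del: of_real_power)
  have "ip z z = ip z x"
    by (subst (2) z_def) (simp add: ip_diff_right ip_smul_right orth)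
  also have "\<dots> = ip x x - c * conjugate (ip x y)"
    by (simp add: z_def ip_diff_left ip_smul_left ip_conjugate)
  also have "\<dots> = of_real ((norm x)\<^sup>2) - (ip x y * conjugate (ip x y)) / of_real ((norm y)\<^sup>2)"
    by (simp add: c_def ip_self)
  also have "\<dots> = of_real ((norm x)\<^sup>2 - (norm (ip x y))\<^sup>2 / (norm y)\<^sup>2)"
    by (simp add: mult_conjugate scaleR_conv_of_real)
  finally show ?thesis
    unfolding ip_self of_real_eq_iff z_def c_def .
qed

lemma Cauchy_Schwarz: "norm (ip x y) \<le> norm x * norm y"
proof (cases "y = 0")
  case False
  have "0 \<le> (norm x)\<^sup>2 - (norm (ip x y))\<^sup>2 / (norm y)\<^sup>2"
    using norm_minus_component[OF False, of x] by (metis zero_le_power2)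
  then have "(norm (ip x y))\<^sup>2 \<le> (norm x * norm y)\<^sup>2"
    using False by (simp add: field_simps power_mult_distrib)
  then show ?thesis by (rule power2_le_imp_le) simp
qed simp

lemma bounded_linear_ip_left: "bounded_linear (\<lambda>x. ip x y)"
  by (rule bounded_linear_intro[where K="norm y"])
    (auto simp: ip_add_left ip_scaleR_left scaleR_conv_of_real Cauchy_Schwarz)

lemma bounded_linear_ip_right: "bounded_linear (ip x)"
  by (rule bounded_linear_intro[where K="norm x"])
    (auto simp: ip_add_right ip_scaleR_right scaleR_conv_of_real Cauchy_Schwarz mult.commute[of _ "norm x"])

section \<open>Orthogonal projections\<close>

lemma closed_subspace_scaleR:
  "closed_subspace smul W \<Longrightarrow> x \<in> W \<Longrightarrow> r *\<^sub>R x \<in> W"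
  using subspace_scale[of W x "of_real r"] by (simp add: closed_subspace_def smul_of_real)

text \<open>
  A minimising sequence for the distance from \<open>f\<close> to \<open>W\<close> is Cauchy, because midpoints stay in \<open>W\<close> and
  the parallelogram law turns near-minimality into closeness. Its limit is a nearest point, and
  removing a nonzero component along a vector of \<open>W\<close> would bring it still nearer.
\<close>

lemma ex_orthogonal_projection:
  assumes W: "closed_subspace smul W"
  shows "\<exists>p\<in>W. \<forall>w\<in>W. ip (f - p) w = 0"
proof -
  have sub: "subspace W" and cl: "closed W" using W by (auto simp: closed_subspace_def)
  define \<delta> where "\<delta> = (INF w\<in>W. (norm (f - w))\<^sup>2)"
  have ne: "W \<noteq> {}" using subspace_0[OF sub] by auto
  have lower: "\<delta> \<le> (norm (f - w))\<^sup>2" if "w \<in> W" for w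
    unfolding \<delta>_def using that by (intro cINF_lower) (auto intro!: bdd_belowI[of _ 0])
  have "\<exists>w\<in>W. (norm (f - w))\<^sup>2 < \<delta> + 1 / real (Suc n)" for n
    using cInf_lessD[of "(\<lambda>w. (norm (f - w))\<^sup>2) ` W" "\<delta> + 1 / real (Suc n)"] ne
    by (auto simp: \<delta>_def)
  then obtain w where wW: "\<And>n. w n \<in> W" and w: "\<And>n. (norm (f - w n))\<^sup>2 < \<delta> + 1 / real (Suc n)"
    by metis
  \<comment> \<open>Parallelogram law for \<open>f - w n\<close> and \<open>f - w m\<close>, whose sum is twice the vector from the midpoint to \<open>f\<close>.\<close>
  have gap: "(norm (w m - w n))\<^sup>2 \<le> 2 / real (Suc m) + 2 / real (Suc n)" for m n
  proof -
    have "(1/2) *\<^sub>R (w m + w n) \<in> W"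
      using wW sub W by (intro closed_subspace_scaleR) (auto intro: subspace_add)
    then have "4 * \<delta> \<le> 4 * (norm (f - (1/2) *\<^sub>R (w m + w n)))\<^sup>2" using lower by simp
    also have "\<dots> = (norm (2 *\<^sub>R (f - (1/2) *\<^sub>R (w m + w n))))\<^sup>2"
      by (simp add: power_mult_distrib)
    also have "2 *\<^sub>R (f - (1/2) *\<^sub>R (w m + w n)) = (f - w n) + (f - w m)"
      by (simp add: algebra_simps scaleR_2)
    finally have "4 * \<delta> \<le> (norm ((f - w n) + (f - w m)))\<^sup>2" .
    moreover have "(f - w n) - (f - w m) = w m - w n" by simp
    ultimately show ?thesis
      using parallelogram_law[of "f - w n" "f - w m"] w[of m] w[of n] by simp
  qed
  have "Cauchy w"
  proof (rule metric_CauchyI)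
    fix e :: real assume "e > 0"
    then obtain N where N: "inverse (real (Suc N)) < e\<^sup>2 / 4"
      using reals_Archimedean[of "e\<^sup>2 / 4"] by auto
    have "dist (w m) (w n) < e" if "m \<ge> N" "n \<ge> N" for m n
    proof -
      have "1 / real (Suc m) \<le> inverse (real (Suc N))" "1 / real (Suc n) \<le> inverse (real (Suc N))"
        using that by (auto simp: field_simps)
      then have "(norm (w m - w n))\<^sup>2 < e\<^sup>2" using gap[of m n] N by simp
      then show ?thesis using \<open>e > 0\<close> by (simp add: dist_norm power2_less_imp_less)
    qed
    then show "\<exists>M. \<forall>m\<ge>M. \<forall>n\<ge>M. dist (w m) (w n) < e" by blast
  qed
  then obtain p where p: "w \<longlonglongrightarrow> p" using Cauchy_convergent convergent_def by blast
  have pW: "p \<in> W" using closed_sequentially[OF cl _ p] wW by blast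
  have "(\<lambda>n. (norm (f - w n))\<^sup>2) \<longlonglongrightarrow> (norm (f - p))\<^sup>2" by (intro tendsto_intros p)
  moreover have "(\<lambda>n. \<delta> + 1 / real (Suc n)) \<longlonglongrightarrow> \<delta> + 0"
    by (intro tendsto_add tendsto_const LIMSEQ_Suc[OF lim_1_over_n])
  ultimately have p_le: "(norm (f - p))\<^sup>2 \<le> \<delta>"
    using LIMSEQ_le[of "\<lambda>n. (norm (f - w n))\<^sup>2" _ "\<lambda>n. \<delta> + 1 / real (Suc n)" \<delta>] less_imp_le[OF w]
    by simp
  have "ip (f - p) u = 0" if u: "u \<in> W" for u
  proof (cases "u = 0")
    case False
    define c where "c = ip (f - p) u / of_real ((norm u)\<^sup>2)"
    have "p + smul c u \<in> W" using sub pW u by (intro subspace_add subspace_scale)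
    then have "(norm (f - p))\<^sup>2 \<le> (norm (f - p - smul c u))\<^sup>2"
      using order_trans[OF p_le lower, of "p + smul c u"] by (simp add: diff_diff_eq)
    also have "\<dots> = (norm (f - p))\<^sup>2 - (norm (ip (f - p) u))\<^sup>2 / (norm u)\<^sup>2"
      unfolding c_def by (rule norm_minus_component[OF False])
    finally have "(norm (ip (f - p) u))\<^sup>2 / (norm u)\<^sup>2 \<le> 0" by simp
    then show ?thesis using False by (simp add: divide_le_0_iff)
  qed simp
  with pW show ?thesis by blast
qed

lemma oproj_eqI:
  assumes W: "closed_subspace smul W" and p: "p \<in> W" "\<And>w. w \<in> W \<Longrightarrow> ip (f - p) w = 0"
  shows "oproj ip W f = p"
  unfolding oproj_def
proof (rule the_equality)
  fix q assume q: "q \<in> W \<and> (\<forall>w\<in>W. ip (f - q) w = 0)"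
  then have "q - p \<in> W" using W p by (auto simp: closed_subspace_def intro: subspace_diff)
  moreover have "q - p = (f - p) - (f - q)" by simp
  ultimately have "ip (q - p) (q - p) = 0" using p q by (metis ip_diff_left diff_zero)
  then show "q = p" by (simp add: ip_self_eq_0_iff)
qed (use p in auto)

lemma
  assumes W: "closed_subspace smul W"
  shows oproj_in: "oproj ip W f \<in> W"
    and oproj_orthogonal: "w \<in> W \<Longrightarrow> ip (f - oproj ip W f) w = 0"
  using ex_orthogonal_projection[OF W, of f] oproj_eqI[OF W] by metis+

lemma ip_oproj_right:
  assumes "closed_subspace smul W" "w \<in> W"
  shows "ip w (oproj ip W f) = ip w f"
  using oproj_orthogonal[OF assms, of f] ip_commute[of w "f - oproj ip W f"]
  by (simp add: ip_diff_right)

lemma ip_oproj_self: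
  assumes "closed_subspace smul W"
  shows "ip (oproj ip W f) f = of_real ((norm (oproj ip W f))\<^sup>2)"
  using ip_oproj_right[OF assms oproj_in[OF assms], of f f] by (simp add: ip_self)

lemma oproj_add:
  assumes W: "closed_subspace smul W"
  shows "oproj ip W (f + g) = oproj ip W f + oproj ip W g"
proof (rule oproj_eqI[OF W])
  show "oproj ip W f + oproj ip W g \<in> W"
    using W by (auto simp: closed_subspace_def intro!: subspace_add oproj_in[OF W])
  show "ip (f + g - (oproj ip W f + oproj ip W g)) w = 0" if "w \<in> W" for w
    using oproj_orthogonal[OF W that, of f] oproj_orthogonal[OF W that, of g]
    by (simp add: ip_diff_left ip_add_left)
qed

lemma oproj_smul:
  assumes W: "closed_subspace smul W"
  shows "oproj ip W (smul c f) = smul c (oproj ip W f)"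
proof (rule oproj_eqI[OF W])
  show "smul c (oproj ip W f) \<in> W"
    using W by (auto simp: closed_subspace_def intro!: subspace_scale oproj_in[OF W])
  show "ip (smul c f - smul c (oproj ip W f)) w = 0" if "w \<in> W" for w
    using oproj_orthogonal[OF W that, of f] by (simp add: ip_diff_left ip_smul_left)
qed

section \<open>Bounded operators\<close>

lemma linear_smulI:
  assumes "\<And>x y. A (x + y) = A x + A y" "\<And>c x. A (smul c x) = smul c (A x)"
  shows "Vector_Spaces.linear smul smul A"
  by unfold_locales (use assms in auto)

lemma bounded_operatorI:
  assumes add: "\<And>x y. A (x + y) = A x + A y" and scale: "\<And>c x. A (smul c x) = smul c (A x)"
    and bound: "\<And>x. norm (A x) \<le> norm x * K"
  shows "bounded_operator smul A"
  unfolding bounded_operator_def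
proof
  show "bounded_linear A"
    by (rule bounded_linear_intro[OF add _ bound]) (metis scale smul_of_real)
qed (rule linear_smulI[OF add scale])

lemma range_closed_subspace:
  assumes A: "bounded_operator smul A" and c: "0 < c" "\<And>x. c * norm x \<le> norm (A x)"
  shows "closed_subspace smul (range A)"
proof -
  interpret A: Vector_Spaces.linear smul smul A using A by (simp add: bounded_operator_def)
  have "subspace (range A)" by (rule A.subspace_image) simp
  moreover have "closed (range A)"
    using A c by (intro closed_range_if_bounded_below[of A c]) (auto simp: bounded_operator_def)
  ultimately show ?thesis by (simp add: closed_subspace_def)
qed

text \<open>
  The range is closed, so \<open>f\<close> has a projection onto it, with a residue \<open>r\<close> orthogonal to the range. Testing
  \<open>r\<close> against \<open>A (A r)\<close> and moving one \<open>A\<close> across gives \<open>A r = 0\<close>, hence \<open>r = 0\<close>.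
\<close>

lemma self_adjoint_bounded_below_surj:
  assumes A: "bounded_operator smul A" and adj: "self_adjoint ip A"
    and c: "0 < c" "\<And>x. c * norm x \<le> norm (A x)"
  shows "surj A"
proof -
  have R: "closed_subspace smul (range A)" using A c by (rule range_closed_subspace)
  have "f \<in> range A" for f
  proof -
    define r where "r = f - oproj ip (range A) f"
    have "ip (A r) (A r) = ip r (A (A r))" using adj by (simp add: self_adjoint_def)
    also have "\<dots> = 0" unfolding r_def by (rule oproj_orthogonal[OF R]) simp
    finally have "c * norm r \<le> 0" using c(2)[of r] by (simp add: ip_self_eq_0_iff)
    then have "r = 0" using c(1) by (simp add: mult_le_0_iff)
    then show ?thesis using oproj_in[OF R, of f] by (simp add: r_def)
  qed
  then show ?thesis by auto
qed

lemma bounded_operator_inv: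
  assumes A: "bounded_operator smul A" and surj: "surj A"
    and c: "0 < c" "\<And>x. c * norm x \<le> norm (A x)"
  shows "inj A" "bounded_operator smul (inv A)"
proof -
  interpret A: Vector_Spaces.linear smul smul A using A by (simp add: bounded_operator_def)
  show inj: "inj A"
  proof (rule injI)
    fix x y assume "A x = A y"
    then have "c * norm (x - y) \<le> 0" using c(2)[of "x - y"] by (simp add: A.diff)
    then show "x = y" using c(1) by (simp add: mult_le_0_iff)
  qed
  have A_inv: "A (inv A x) = x" for x using surj by (simp add: surj_f_inv_f)
  show "bounded_operator smul (inv A)"
  proof (rule bounded_operatorI)
    show "inv A (x + y) = inv A x + inv A y" for x y
      by (rule inv_f_eq[OF inj]) (simp add: A.add A_inv)
    show "inv A (smul a x) = smul a (inv A x)" for a x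
      by (rule inv_f_eq[OF inj]) (simp add: A.scale A_inv)
    show "norm (inv A x) \<le> norm x * (1 / c)" for x
      using c(2)[of "inv A x"] c(1) by (simp add: A_inv field_simps)
  qed
qed

end

section \<open>Synthesis and analysis for a frame of subspaces\<close>

locale subspace_frame = hilbert_space smul ip
  for smul :: "'k::real_or_complex \<Rightarrow> 'a::banach \<Rightarrow> 'a" and ip :: "'a \<Rightarrow> 'a \<Rightarrow> 'k" +
  fixes I :: "'i set" and W :: "'i \<Rightarrow> 'a set" and v :: "'i \<Rightarrow> real" and C D :: real
  assumes frame: "frame_of_subspaces smul ip I W v C D"
begin

abbreviation P :: "'i \<Rightarrow> 'a \<Rightarrow> 'a" where "P i \<equiv> oproj ip (W i)"
abbreviation S :: "'a \<Rightarrow> 'a" where "S \<equiv> frame_operator ip I W v"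

abbreviation energy :: "'a \<Rightarrow> real" where
  "energy f \<equiv> \<Sum>\<^sub>\<infinity>i\<in>I. (v i)\<^sup>2 * (norm (P i f))\<^sup>2"

lemma W: "i \<in> I \<Longrightarrow> closed_subspace smul (W i)"
  and C_pos: "0 < C" and D_nonneg: "0 \<le> D"
  and energy_summable: "(\<lambda>i. (v i)\<^sup>2 * (norm (P i f))\<^sup>2) summable_on I"
  and energy_lower: "C * (norm f)\<^sup>2 \<le> energy f"
  and energy_upper: "energy f \<le> D * (norm f)\<^sup>2"
  using frame by (auto simp: frame_of_subspaces_def)

lemma W_sub: "i \<in> I \<Longrightarrow> subspace (W i)"
  using W by (simp add: closed_subspace_def)

text \<open>
  Write \<open>g\<close> for the finite sum. In \<open>ip g g\<close> each \<open>h i\<close> sees only the projection \<open>P i g\<close>, so the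
  Cauchy-Schwarz inequality for finite sums bounds \<open>(norm g)\<^sup>2\<close> by the \<open>\<ell>\<^sub>2\<close> norm of \<open>h\<close> times
  the square root of the energy of \<open>g\<close>, which is at most \<open>sqrt D * norm g\<close>. The claim is the
  square of this estimate, divided by \<open>(norm g)\<^sup>2\<close>.
\<close>

lemma norm_finite_synthesis:
  assumes F: "finite F" "F \<subseteq> I" and h: "\<And>i. i \<in> F \<Longrightarrow> h i \<in> W i"
  shows "(norm (\<Sum>i\<in>F. v i *\<^sub>R h i))\<^sup>2 \<le> D * (\<Sum>i\<in>F. (norm (h i))\<^sup>2)"
proof -
  define g where "g = (\<Sum>i\<in>F. v i *\<^sub>R h i)"
  have "ip g g = (\<Sum>i\<in>F. ip (v i *\<^sub>R h i) g)"
    by (subst (1) g_def) (rule bounded_linear.linear[OF bounded_linear_ip_left, THEN linear_sum])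
  also have "\<dots> = (\<Sum>i\<in>F. of_real (v i) * ip (h i) (P i g))"
    using F(2) h W by (intro sum.cong) (auto simp: ip_scaleR_left ip_oproj_right)
  finally have "(norm g)\<^sup>2 = norm (\<Sum>i\<in>F. of_real (v i) * ip (h i) (P i g))"
    by (metis ip_self norm_of_real abs_of_nonneg zero_le_power2)
  also have "\<dots> \<le> (\<Sum>i\<in>F. \<bar>norm (h i)\<bar> * \<bar>v i * norm (P i g)\<bar>)"
    using mult_left_mono[OF Cauchy_Schwarz abs_ge_zero]
    by (intro sum_norm_le) (simp add: norm_mult abs_mult mult_ac)
  also have "\<dots> \<le> L2_set (\<lambda>i. norm (h i)) F * L2_set (\<lambda>i. v i * norm (P i g)) F"
    by (rule L2_set_mult_ineq)
  finally have "((norm g)\<^sup>2)\<^sup>2 \<le> (L2_set (\<lambda>i. norm (h i)) F * L2_set (\<lambda>i. v i * norm (P i g)) F)\<^sup>2"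
    by (rule power_mono) simp
  also have "\<dots> = (\<Sum>i\<in>F. (norm (h i))\<^sup>2) * (\<Sum>i\<in>F. (v i)\<^sup>2 * (norm (P i g))\<^sup>2)"
    by (simp add: L2_set_def power_mult_distrib sum_nonneg)
  also have "\<dots> \<le> (\<Sum>i\<in>F. (norm (h i))\<^sup>2) * (D * (norm g)\<^sup>2)"
    using finite_sum_le_infsum[OF energy_summable F, of g] energy_upper[of g]
    by (intro mult_left_mono sum_nonneg) auto
  finally have "(norm g)\<^sup>2 * (norm g)\<^sup>2 \<le> (D * (\<Sum>i\<in>F. (norm (h i))\<^sup>2)) * (norm g)\<^sup>2"
    by (simp add: power2_eq_square mult_ac)
  then have "(norm g)\<^sup>2 \<le> D * (\<Sum>i\<in>F. (norm (h i))\<^sup>2)"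
    using mult_right_le_imp_le[of "(norm g)\<^sup>2" "(norm g)\<^sup>2"]
    by (cases "g = 0") (auto simp: D_nonneg sum_nonneg)
  then show ?thesis by (simp add: g_def)
qed

lemma synthesis_has_sum:
  assumes h: "h \<in> l2_sum I W"
  shows "((\<lambda>i. v i *\<^sub>R h i) has_sum synthesis I W v h) I"
proof -
  have "(\<lambda>i. v i *\<^sub>R h i) summable_on I"
  proof (rule summable_on_if_norm_sum_square_le)
    show "(\<lambda>i. D * (norm (h i))\<^sup>2) summable_on I"
      using h by (intro summable_on_cmult_right) (simp add: l2_sum_def)
    show "(norm (\<Sum>i\<in>F. v i *\<^sub>R h i))\<^sup>2 \<le> (\<Sum>i\<in>F. D * (norm (h i))\<^sup>2)"
      if "finite F" "F \<subseteq> I" for F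
      using norm_finite_synthesis[OF that, of h] h that
      by (auto simp: l2_sum_def sum_distrib_left)
  qed
  then show ?thesis using h by (simp add: synthesis_def)
qed

lemma norm_synthesis:
  assumes h: "h \<in> l2_sum I W"
  shows "(norm (synthesis I W v h))\<^sup>2 \<le> D * (\<Sum>\<^sub>\<infinity>i\<in>I. (norm (h i))\<^sup>2)"
proof -
  have sq: "(\<lambda>i. (norm (h i))\<^sup>2) summable_on I" using h by (simp add: l2_sum_def)
  have hW: "h i \<in> W i" if "i \<in> I" for i using h that by (auto simp: l2_sum_def)
  have lim: "((\<lambda>F. (norm (\<Sum>i\<in>F. v i *\<^sub>R h i))\<^sup>2) \<longlongrightarrow> (norm (synthesis I W v h))\<^sup>2)
      (finite_subsets_at_top I)"
    using synthesis_has_sum[OF h] unfolding has_sum_def by (intro tendsto_power tendsto_norm)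
  have "(norm (\<Sum>i\<in>F. v i *\<^sub>R h i))\<^sup>2 \<le> D * (\<Sum>\<^sub>\<infinity>i\<in>I. (norm (h i))\<^sup>2)"
    if F: "finite F" "F \<subseteq> I" for F
  proof -
    have "(norm (\<Sum>i\<in>F. v i *\<^sub>R h i))\<^sup>2 \<le> D * (\<Sum>i\<in>F. (norm (h i))\<^sup>2)"
      using F hW by (intro norm_finite_synthesis) auto
    also have "\<dots> \<le> D * (\<Sum>\<^sub>\<infinity>i\<in>I. (norm (h i))\<^sup>2)"
      using F by (intro mult_left_mono finite_sum_le_infsum[OF sq] D_nonneg) auto
    finally show ?thesis .
  qed
  then have "\<forall>\<^sub>F F in finite_subsets_at_top I.
      (norm (\<Sum>i\<in>F. v i *\<^sub>R h i))\<^sup>2 \<le> D * (\<Sum>\<^sub>\<infinity>i\<in>I. (norm (h i))\<^sup>2)"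
    by (rule eventually_finite_subsets_at_top_weakI)
  with lim show ?thesis
    by (rule tendsto_upperbound) (rule finite_subsets_at_top_neq_bot)
qed

lemma analysis_in_l2_sum: "(\<lambda>i\<in>I. v i *\<^sub>R P i f) \<in> l2_sum I W"
proof -
  have "(\<lambda>i. (norm ((\<lambda>i\<in>I. v i *\<^sub>R P i f) i))\<^sup>2) summable_on I \<longleftrightarrow>
      (\<lambda>i. (v i)\<^sup>2 * (norm (P i f))\<^sup>2) summable_on I"
    by (rule summable_on_cong) (simp add: power_mult_distrib)
  moreover have "v i *\<^sub>R P i f \<in> W i" if "i \<in> I" for i
    using closed_subspace_scaleR[OF W oproj_in[OF W]] that by blast
  then have "(\<lambda>i\<in>I. v i *\<^sub>R P i f) \<in> Pi\<^sub>E I W" by (simp add: restrict_PiE_iff)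
  ultimately show ?thesis
    using energy_summable[of f] by (simp only: l2_sum_def mem_Collect_eq simp_thms)
qed

lemma ip_synthesis:
  assumes h: "h \<in> l2_sum I W"
  shows "ip (synthesis I W v h) f = l2_ip ip I h (\<lambda>i\<in>I. v i *\<^sub>R P i f)"
proof -
  have "((\<lambda>i. ip (v i *\<^sub>R h i) f) has_sum ip (synthesis I W v h) f) I"
    by (rule has_sum_bounded_linear[OF bounded_linear_ip_left synthesis_has_sum[OF h]])
  then have "ip (synthesis I W v h) f = (\<Sum>\<^sub>\<infinity>i\<in>I. ip (v i *\<^sub>R h i) f)"
    by (simp add: infsumI)
  also have "\<dots> = l2_ip ip I h (\<lambda>i\<in>I. v i *\<^sub>R P i f)"
    unfolding l2_ip_def using h W
    by (intro infsum_cong) (auto simp: l2_sum_def ip_scaleR_left ip_scaleR_right ip_oproj_right PiE_mem)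
  finally show ?thesis .
qed

text \<open>
  Nondegeneracy of the inner product of the direct sum, by testing with families supported at
  a single index. It makes the adjoint of synthesis unique, so that the description in the definition of
  \<^const>\<open>analysis\<close> singles out one family.
\<close>

lemma l2_ip_determines:
  assumes g: "g \<in> l2_sum I W" "g' \<in> l2_sum I W"
    and eq: "\<And>h. h \<in> l2_sum I W \<Longrightarrow> l2_ip ip I h g = l2_ip ip I h g'"
  shows "g = g'"
proof (rule PiE_ext)
  show "g \<in> Pi\<^sub>E I W" "g' \<in> Pi\<^sub>E I W" using g by (auto simp: l2_sum_def)
  fix j assume j: "j \<in> I"
  define w where "w = g j - g' j"
  have wW: "w \<in> W j" using g j W_sub[OF j] by (auto simp: w_def l2_sum_def intro!: subspace_diff)
  define h where "h = (\<lambda>i\<in>I. if i = j then w else 0)"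
  have pick: "(\<Sum>\<^sub>\<infinity>i\<in>I. k i) = k j" if "\<And>i. i \<in> I \<Longrightarrow> i \<noteq> j \<Longrightarrow> k i = 0" for k :: "'i \<Rightarrow> 'k"
  proof -
    have "(\<Sum>\<^sub>\<infinity>i\<in>I. k i) = (\<Sum>\<^sub>\<infinity>i\<in>{j}. k i)"
      using that j by (intro infsum_cong_neutral) auto
    then show ?thesis by simp
  qed
  have "(\<lambda>i. (norm (h i))\<^sup>2) summable_on I \<longleftrightarrow> (\<lambda>i. (norm (h i))\<^sup>2) summable_on {j}"
    using j by (intro summable_on_cong_neutral) (auto simp: h_def)
  then have "h \<in> l2_sum I W"
    using wW subspace_0[OF W_sub] by (auto simp: l2_sum_def h_def)
  then have "l2_ip ip I h g = l2_ip ip I h g'" by (rule eq)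
  then have "ip w (g j) = ip w (g' j)"
    unfolding l2_ip_def using pick[of "\<lambda>i. ip (h i) (g i)"] pick[of "\<lambda>i. ip (h i) (g' i)"] j
    by (simp add: h_def)
  then have "ip w w = 0" by (subst (2) w_def) (simp add: ip_diff_right)
  then show "g j = g' j" by (simp add: ip_self_eq_0_iff w_def)
qed

lemma analysis_eq: "analysis ip I W v f = (\<lambda>i\<in>I. v i *\<^sub>R P i f)"
  unfolding analysis_def
proof (rule the_equality)
  fix g assume g: "g \<in> l2_sum I W \<and> (\<forall>h\<in>l2_sum I W. ip (synthesis I W v h) f = l2_ip ip I h g)"
  then show "g = (\<lambda>i\<in>I. v i *\<^sub>R P i f)"
    using analysis_in_l2_sum by (intro l2_ip_determines) (auto simp: ip_synthesis)
qed (simp add: analysis_in_l2_sum ip_synthesis)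

section \<open>The frame operator\<close>

lemma S_has_sum: "((\<lambda>i. (v i)\<^sup>2 *\<^sub>R P i f) has_sum S f) I"
proof -
  have "((\<lambda>i. v i *\<^sub>R (\<lambda>i\<in>I. v i *\<^sub>R P i f) i) has_sum S f) I"
    unfolding frame_operator_def analysis_eq by (rule synthesis_has_sum[OF analysis_in_l2_sum])
  then show ?thesis
    by (rule has_sum_cong[THEN iffD1, rotated]) (simp add: power2_eq_square)
qed

lemma ip_S_self: "ip (S f) f = of_real (energy f)"
proof -
  have "((\<lambda>i. ip ((v i)\<^sup>2 *\<^sub>R P i f) f) has_sum ip (S f) f) I"
    by (rule has_sum_bounded_linear[OF bounded_linear_ip_left S_has_sum])
  moreover have "((\<lambda>i. of_real ((v i)\<^sup>2 * (norm (P i f))\<^sup>2)) has_sum (of_real (energy f) :: 'k)) I"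
    using energy_summable by (intro has_sum_of_real) simp
  then have "((\<lambda>i. ip ((v i)\<^sup>2 *\<^sub>R P i f) f) has_sum of_real (energy f)) I"
    by (rule has_sum_cong[THEN iffD1, rotated]) (simp add: ip_scaleR_left ip_oproj_self W)
  ultimately show ?thesis by (rule has_sum_unique)
qed

lemma S_self_adjoint: "self_adjoint ip S"
  unfolding self_adjoint_def
proof (intro allI)
  fix f g
  have "((\<lambda>i. ip ((v i)\<^sup>2 *\<^sub>R P i f) g) has_sum ip (S f) g) I"
    by (rule has_sum_bounded_linear[OF bounded_linear_ip_left S_has_sum])
  moreover have "((\<lambda>i. ip f ((v i)\<^sup>2 *\<^sub>R P i g)) has_sum ip f (S g)) I"
    by (rule has_sum_bounded_linear[OF bounded_linear_ip_right S_has_sum])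
  moreover have "ip ((v i)\<^sup>2 *\<^sub>R P i f) g = ip f ((v i)\<^sup>2 *\<^sub>R P i g)" if "i \<in> I" for i
    using ip_oproj_right[OF W oproj_in[OF W], OF that that, of f g]
      ip_oproj_right[OF W oproj_in[OF W], OF that that, of g f]
    by (metis ip_scaleR_left ip_scaleR_right ip_conjugate)
  then have "((\<lambda>i. ip ((v i)\<^sup>2 *\<^sub>R P i f) g) has_sum ip f (S g)) I \<longleftrightarrow>
      ((\<lambda>i. ip f ((v i)\<^sup>2 *\<^sub>R P i g)) has_sum ip f (S g)) I"
    by (rule has_sum_cong)
  ultimately show "ip (S f) g = ip f (S g)" using has_sum_unique by blast
qed

lemma norm_S_le: "norm (S f) \<le> norm f * D"
proof -
  have "(norm (S f))\<^sup>2 \<le> D * (\<Sum>\<^sub>\<infinity>i\<in>I. (norm ((\<lambda>i\<in>I. v i *\<^sub>R P i f) i))\<^sup>2)"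
    unfolding frame_operator_def analysis_eq by (rule norm_synthesis[OF analysis_in_l2_sum])
  also have "(\<Sum>\<^sub>\<infinity>i\<in>I. (norm ((\<lambda>i\<in>I. v i *\<^sub>R P i f) i))\<^sup>2) = energy f"
    by (rule infsum_cong) (simp add: power_mult_distrib)
  also have "D * energy f \<le> D * (D * (norm f)\<^sup>2)"
    using energy_upper D_nonneg by (rule mult_left_mono)
  finally have "(norm (S f))\<^sup>2 \<le> (norm f * D)\<^sup>2" by (simp add: power2_eq_square mult_ac)
  then show ?thesis by (rule power2_le_imp_le) (simp add: D_nonneg)
qed

text \<open>
  Linearity is inherited from the projections through the series of \<open>S\<close> and uniqueness of its sum.
\<close>

lemma S_bounded_operator: "bounded_operator smul S"
proof (rule bounded_operatorI[OF _ _ norm_S_le])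
  fix f g
  have "((\<lambda>i. (v i)\<^sup>2 *\<^sub>R P i f + (v i)\<^sup>2 *\<^sub>R P i g) has_sum S f + S g) I"
    by (intro has_sum_add S_has_sum)
  then have "((\<lambda>i. (v i)\<^sup>2 *\<^sub>R P i (f + g)) has_sum S f + S g) I"
    by (rule has_sum_cong[THEN iffD1, rotated]) (simp add: oproj_add W scaleR_add_right)
  then show "S (f + g) = S f + S g" using S_has_sum has_sum_unique by blast
next
  fix c f
  have "((\<lambda>i. smul c ((v i)\<^sup>2 *\<^sub>R P i f)) has_sum smul c (S f)) I"
    by (rule has_sum_bounded_linear[OF bounded_linear_smul S_has_sum])
  then have "((\<lambda>i. (v i)\<^sup>2 *\<^sub>R P i (smul c f)) has_sum smul c (S f)) I"
    by (rule has_sum_cong[THEN iffD1, rotated]) (simp add: oproj_smul W smul_scaleR_commute)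
  then show "S (smul c f) = smul c (S f)" using S_has_sum has_sum_unique by blast
qed

lemma S_bounded_below: "C * norm f \<le> norm (S f)"
proof (cases "f = 0")
  case False
  have "C * (norm f)\<^sup>2 \<le> norm (ip (S f) f)"
    using energy_lower[of f] by (simp add: ip_S_self)
  also have "\<dots> \<le> norm (S f) * norm f" by (rule Cauchy_Schwarz)
  finally show ?thesis using False by (simp add: power2_eq_square)
qed simp

lemma S_surj: "surj S"
  using S_bounded_operator S_self_adjoint C_pos S_bounded_below
  by (rule self_adjoint_bounded_below_surj)

lemmas S_inj = bounded_operator_inv(1)[OF S_bounded_operator S_surj C_pos S_bounded_below]
lemmas S_inv = bounded_operator_inv(2)[OF S_bounded_operator S_surj C_pos S_bounded_below]

lemma S_invertible: "invertible_operator smul S"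
  unfolding invertible_operator_def using S_inv S_inj S_surj
  by (intro exI[of _ "inv S"]) (simp add: surj_iff)

lemma S_positive: "positive_operator ip S"
  unfolding positive_operator_def ip_S_self by (intro allI of_real_nonneg infsum_nonneg) simp

lemma S_ge: "operator_le ip (\<lambda>f. C *\<^sub>R f) S"
proof -
  have "ip (S f - C *\<^sub>R f) f = of_real (energy f - C * (norm f)\<^sup>2)" for f
    by (simp add: ip_diff_left ip_scaleR_left ip_S_self ip_self)
  then show ?thesis
    unfolding operator_le_def positive_operator_def
    using energy_lower by (auto intro!: of_real_nonneg simp del: of_real_diff)
qed

lemma S_le: "operator_le ip S (\<lambda>f. D *\<^sub>R f)"
proof -
  have "ip (D *\<^sub>R f - S f) f = of_real (D * (norm f)\<^sup>2 - energy f)" for f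
    by (simp add: ip_diff_left ip_scaleR_left ip_S_self ip_self)
  then show ?thesis
    unfolding operator_le_def positive_operator_def
    using energy_upper by (auto intro!: of_real_nonneg simp del: of_real_diff)
qed

section \<open>Reconstruction\<close>

lemma inv_S_bounded_linear: "bounded_linear (inv S)"
  using S_inv by (simp add: bounded_operator_def)

lemma reconstruction_has_sum: "((\<lambda>i. (v i)\<^sup>2 *\<^sub>R inv S (P i f)) has_sum f) I"
proof -
  have "((\<lambda>i. inv S ((v i)\<^sup>2 *\<^sub>R P i f)) has_sum inv S (S f)) I"
    by (rule has_sum_bounded_linear[OF inv_S_bounded_linear S_has_sum])
  then show ?thesis
    by (simp add: S_inj linear_scale[OF bounded_linear.linear[OF inv_S_bounded_linear]])
qed

lemma dual_coefficients_in_l2_sum: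
  "(\<lambda>i\<in>I. inv S (analysis ip I W v f i)) \<in> l2_sum I (\<lambda>i. inv S ` W i)"
proof -
  obtain K where K: "\<And>x. norm (inv S x) \<le> norm x * K"
    using bounded_linear.bounded[OF inv_S_bounded_linear] by blast
  have g: "analysis ip I W v f \<in> l2_sum I W"
    unfolding analysis_eq by (rule analysis_in_l2_sum)
  have "(\<lambda>i. (norm ((\<lambda>i\<in>I. inv S (analysis ip I W v f i)) i))\<^sup>2) summable_on I"
  proof (rule summable_on_comparison_test)
    show "(\<lambda>i. (norm (analysis ip I W v f i))\<^sup>2 * K\<^sup>2) summable_on I"
      using g by (intro summable_on_cmult_left) (simp add: l2_sum_def)
    show "(norm ((\<lambda>i\<in>I. inv S (analysis ip I W v f i)) i))\<^sup>2 \<le> (norm (analysis ip I W v f i))\<^sup>2 * K\<^sup>2"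
      if "i \<in> I" for i
      using power_mono[OF K norm_ge_zero, of "analysis ip I W v f i" 2] that
      by (simp add: power_mult_distrib)
  qed simp
  then show ?thesis using g by (auto simp: l2_sum_def PiE_mem)
qed

text \<open>
  One factor \<open>v i\<close> comes from synthesis and the other from analysis, so this is the reconstruction series.
\<close>

lemma dual_synthesis_analysis:
  "synthesis I (\<lambda>i. inv S ` W i) v (\<lambda>i\<in>I. inv S (analysis ip I W v f i)) = f"
proof -
  have "synthesis I (\<lambda>i. inv S ` W i) v (\<lambda>i\<in>I. inv S (analysis ip I W v f i)) =
      (\<Sum>\<^sub>\<infinity>i\<in>I. v i *\<^sub>R (\<lambda>i\<in>I. inv S (analysis ip I W v f i)) i)"
    using dual_coefficients_in_l2_sum by (simp add: synthesis_def)
  also have "\<dots> = (\<Sum>\<^sub>\<infinity>i\<in>I. (v i)\<^sup>2 *\<^sub>R inv S (P i f))"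
    by (rule infsum_cong)
      (simp add: analysis_eq power2_eq_square linear_scale[OF bounded_linear.linear[OF inv_S_bounded_linear]])
  also have "\<dots> = f" by (rule infsumI[OF reconstruction_has_sum])
  finally show ?thesis .
qed

end

theorem proposition3p16:
  fixes smul :: "'k::real_or_complex \<Rightarrow> 'a::banach \<Rightarrow> 'a"
    and ip :: "'a \<Rightarrow> 'a \<Rightarrow> 'k"
    and I :: "'i set" and W :: "'i \<Rightarrow> 'a set" and v :: "'i \<Rightarrow> real" and C D :: real
  assumes "hilbert_space smul ip"
    and "separable_space (euclidean :: 'a topology)"
    and "frame_of_subspaces smul ip I W v C D"
  shows "let S = frame_operator ip I W v in
      bounded_operator smul S \<and> positive_operator ip S \<and> self_adjoint ip S \<and>
      invertible_operator smul S \<and>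
      operator_le ip (\<lambda>f. C *\<^sub>R f) S \<and> operator_le ip S (\<lambda>f. D *\<^sub>R f) \<and>
      (\<forall>f. (\<lambda>i\<in>I. inv S (analysis ip I W v f i)) \<in> l2_sum I (\<lambda>i. inv S ` W i) \<and>
           f = synthesis I (\<lambda>i. inv S ` W i) v (\<lambda>i\<in>I. inv S (analysis ip I W v f i)) \<and>
           ((\<lambda>i. (v i)\<^sup>2 *\<^sub>R inv S (oproj ip (W i) f)) has_sum f) I)"
proof -
  interpret subspace_frame smul ip I W v C D
    by (intro subspace_frame.intro subspace_frame_axioms.intro assms)
  show ?thesis
    unfolding Let_def
    using S_bounded_operator S_positive S_self_adjoint S_invertible S_ge S_le
      dual_coefficients_in_l2_sum dual_synthesis_analysis reconstruction_has_sum
    by simp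
qed

end
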